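(* Let $p$ be a prime number, let $a,m\in\mathbb{Z}_{\geq0}$ with $\gcd(a,p)=1$, and let $\theta\in\mathbb{F}_{p^p}$ satisfy $\theta^p=\theta+1$. Put $\tau_{p}(a):=\sum_{j=1}^{p-1} j\,p^{ja-1}$. Then the following congruence holds in $\mathbb{F}_{p}[\lambda]$: \[ a^{m}b_{m}(a^{-1}, \lambda) \equiv - \mathrm{Tr}(\theta^{\tau_{p}(a)})\,\mathrm{Tr}\left( \frac{(a\lambda+\theta)^{m}}{\theta^{1+\tau_{p}(a)}} \right) \pmod{p}. \]
   Context: $S(m,j)$ denotes the Stirling number of the second kind, $R(n,j,\lambda):=\sum_{m\ge0}\binom{n}{m}S(m,j)\lambda^{n-m}$ and $b_n(x,\lambda):=\sum_{j\ge0}R(n,j,\lambda)x^j\in\mathbb{Z}[x,\lambda]$ is the weighted Bell polynomial. $a^{-1}$ denotes the inverse of $a$ modulo $p$, and the left side is the image in $\mathbb{F}_p[\lambda]$. $\mathrm{Tr}:\mathbb{F}_{p^p}\to\mathbb{F}_p$ is the trace map, extended $\mathbb{F}_p[\lambda]$-linearly (coefficientwise in $\lambda$) to $\mathbb{F}_{p^p}[\lambda]\to\mathbb{F}_p[\lambda]$. *)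

theory Defs
  imports "Berlekamp_Zassenhaus.Finite_Field" "HOL-Combinatorics.Stirling"
begin

text \<open>
  The sums over all \<open>m \<ge> 0\<close> and \<open>j \<ge> 0\<close> are cut off at \<open>n\<close>: beyond it the binomial
  coefficient, respectively every \<open>S(m, j)\<close> with \<open>m \<le> n\<close>, vanishes.
\<close>

definition stirling_R :: "nat \<Rightarrow> nat \<Rightarrow> int poly" where
  "stirling_R n j = (\<Sum>m\<le>n. monom (of_nat ((n choose m) * Stirling m j)) (n - m))"

text \<open>An element of \<open>\<int>[\<lambda>][x]\<close>: the outer variable is \<open>x\<close>, the coefficients are polynomials in \<open>\<lambda>\<close>.\<close>

definition weighted_bell :: "nat \<Rightarrow> int poly poly" where
  "weighted_bell n = (\<Sum>j\<le>n. monom (stirling_R n j) j)"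

text \<open>The image of \<open>b\<^sub>n(c, \<lambda>)\<close> in \<open>\<bbbF>\<^sub>p[\<lambda>]\<close> for \<open>c \<in> \<bbbF>\<^sub>p\<close>.\<close>

definition weighted_bell_mod :: "nat \<Rightarrow> 'p::prime_card mod_ring \<Rightarrow> 'p mod_ring poly" where
  "weighted_bell_mod n c = poly (map_poly (map_poly of_int) (weighted_bell n)) [:c:]"

text \<open>
  For \<open>a > 0\<close> every exponent \<open>j * a - 1\<close> is an honest natural number; \<open>a = 0\<close> is excluded by
  coprimality with \<open>p\<close>.
\<close>

definition tau :: "nat \<Rightarrow> nat \<Rightarrow> nat" where
  "tau p a = (\<Sum>j = 1..p-1. j * p ^ (j * a - 1))"

text \<open>
  The map \<open>\<bbbF>\<^sub>p \<rightarrow> K\<close>; it is the (unique) ring embedding when \<open>K\<close> has characteristic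
  \<open>p = CARD('p)\<close>.
\<close>

definition embed_Fp :: "'p::prime_card mod_ring \<Rightarrow> 'k::finite_field" where
  "embed_Fp c = of_int (to_int_mod_ring c)"

text \<open>
  The trace of \<open>\<bbbF>\<^bsub>p^p\<^esub>\<close> over \<open>\<bbbF>\<^sub>p\<close>, as the sum of the \<open>p\<close> conjugates under the
  Frobenius map; only meaningful when \<open>'k\<close> has \<open>p ^ p\<close> elements. The sum lies in the image of
  \<open>\<bbbF>\<^sub>p\<close> and is pulled back along the embedding, see \<open>embed_Fp_Tr\<close> below.
\<close>

definition Tr :: "'k::finite_field \<Rightarrow> 'p::prime_card mod_ring" where
  "Tr x = (THE c. embed_Fp c = (\<Sum>i<CARD('p). x ^ (CARD('p) ^ i)))"

context
  fixes kk :: "'k::finite_field itself" and pp :: "'p::prime_card itself"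
  assumes card_k: "CARD('k) = CARD('p) ^ CARD('p)"
begin

lemma CHAR_eq_CARD: "CHAR('k) = CARD('p)"
proof -
  have pr: "prime CARD('p)" by (rule prime_card)
  have "CHAR('k) dvd CARD('p) ^ CARD('p)"
    using CHAR_dvd_CARD[where ?'a = 'k] card_k by simp
  hence "CHAR('k) dvd CARD('p)"
    using prime_dvd_power[of "CHAR('k)"] CHAR_prime by blast
  thus ?thesis using pr CHAR_prime primes_dvd_imp_eq by blast
qed

lemma embed_Fp_of_int: "embed_Fp (of_int n :: 'p mod_ring) = (of_int n :: 'k)"
proof -
  have "to_int_mod_ring (of_int n :: 'p mod_ring) = n mod int CARD('p)"
    by (metis of_int_mod_ring.rep_eq of_int_of_int_mod_ring to_int_mod_ring.rep_eq)
  thus ?thesis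
    unfolding embed_Fp_def using of_int_mod_CHAR[where ?'a = 'k, of n] CHAR_eq_CARD by simp
qed

lemma embed_Fp_add: "embed_Fp (c + d :: 'p mod_ring) = (embed_Fp c + embed_Fp d :: 'k)"
  and embed_Fp_mult: "embed_Fp (c * d :: 'p mod_ring) = (embed_Fp c * embed_Fp d :: 'k)"
proof -
  obtain m n where "c = of_int m" "d = of_int n"
    by (metis of_int_mod_ring_to_int_mod_ring of_int_of_int_mod_ring)
  thus "embed_Fp (c + d :: 'p mod_ring) = (embed_Fp c + embed_Fp d :: 'k)"
       "embed_Fp (c * d :: 'p mod_ring) = (embed_Fp c * embed_Fp d :: 'k)"
    by (simp_all add: embed_Fp_of_int flip: of_int_add of_int_mult)
qed

lemma inj_embed_Fp: "inj (embed_Fp :: 'p mod_ring \<Rightarrow> 'k)"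
proof (rule injI)
  fix c d :: "'p mod_ring" assume eq: "embed_Fp c = (embed_Fp d :: 'k)"
  have "(of_int (to_int_mod_ring c - to_int_mod_ring d) :: 'k) = 0"
    using eq by (simp add: embed_Fp_def)
  hence "int CARD('p) dvd to_int_mod_ring c - to_int_mod_ring d"
    using of_int_eq_0_iff_char_dvd[where ?'a = 'k] CHAR_eq_CARD by metis
  moreover have "to_int_mod_ring c \<in> {0..<int CARD('p)}" "to_int_mod_ring d \<in> {0..<int CARD('p)}"
    using range_to_int_mod_ring[where ?'a = 'p] by blast+
  ultimately have "to_int_mod_ring c = to_int_mod_ring d"
    by (metis atLeastLessThan_iff mod_eq_dvd_iff mod_pos_pos_trivial)
  thus "c = d" by (metis of_int_mod_ring_to_int_mod_ring)
qed

lemma range_embed_Fp: "range (embed_Fp :: 'p mod_ring \<Rightarrow> 'k) = {y. y ^ CARD('p) = y}"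
proof -
  define q :: "'k poly" where "q = monom 1 CARD('p) - monom 1 1"
  have gt: "CARD('p) > 1" using prime_card prime_gt_1_nat by blast
  have deg: "degree q \<le> CARD('p)"
    unfolding q_def using gt by (intro degree_diff_le) (auto simp: degree_monom_eq)
  have "coeff q 1 = -1" using gt by (simp add: q_def)
  hence q0: "q \<noteq> 0" by auto
  have roots: "{y. poly q y = 0} = {y. y ^ CARD('p) = y}"
    by (auto simp: q_def poly_monom)
  have le: "card {y::'k. y ^ CARD('p) = y} \<le> CARD('p)"
    using card_poly_roots_bound[OF q0] deg unfolding roots by linarith
  have sub: "range (embed_Fp :: 'p mod_ring \<Rightarrow> 'k) \<subseteq> {y. y ^ CARD('p) = y}"
  proof
    fix y :: 'k assume "y \<in> range (embed_Fp :: 'p mod_ring \<Rightarrow> 'k)"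
    then obtain c :: "'p mod_ring" where y: "y = embed_Fp c" by blast
    have 1: "embed_Fp (c ^ n) = (embed_Fp c ^ n :: 'k)" for n
      using embed_Fp_of_int[of 1] by (induction n) (simp_all add: embed_Fp_mult)
    have "c ^ CARD('p) = c"
      using finite_field_power_card_eq_same[of c] by simp
    thus "y \<in> {y. y ^ CARD('p) = y}" using 1[of "CARD('p)"] y by simp
  qed
  have "card (range (embed_Fp :: 'p mod_ring \<Rightarrow> 'k)) = CARD('p)"
    using card_image[OF inj_embed_Fp] by simp
  thus ?thesis using card_seteq[OF _ sub] le by simp
qed

lemma embed_Fp_Tr:
  "embed_Fp (Tr x :: 'p mod_ring) = (\<Sum>i<CARD('p). (x :: 'k) ^ (CARD('p) ^ i))"
proof -
  let ?p = "CARD('p)"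
  let ?s = "\<Sum>i<?p. x ^ (?p ^ i)"
  have "?s ^ ?p = (\<Sum>i<?p. (x ^ (?p ^ i)) ^ ?p)"
    using freshmans_dream_sum[where ?'a = 'k, OF CHAR_prime CHAR_eq_CARD[symmetric]] .
  also have "\<dots> = (\<Sum>i<?p. x ^ (?p ^ Suc i))"
    by (simp add: power_mult mult.commute[of ?p] flip: power_mult)
  also have "\<dots> = (\<Sum>i<Suc ?p. x ^ (?p ^ i)) - x"
    by (subst sum.lessThan_Suc_shift) simp
  also have "\<dots> = ?s + x ^ (?p ^ ?p) - x" by simp
  also have "x ^ (?p ^ ?p) = x"
    using finite_field_power_card_eq_same[of x] card_k by simp
  finally have "?s \<in> range (embed_Fp :: 'p mod_ring \<Rightarrow> 'k)"
    unfolding range_embed_Fp by simp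
  then obtain c :: "'p mod_ring" where c: "embed_Fp c = ?s" by force
  show ?thesis unfolding Tr_def
    by (rule theI[of _ c]) (use c inj_embed_Fp in \<open>metis injD\<close>)+
qed

end

end

theory Submission
  imports Defs
begin

text \<open>
  Expand \<open>\<theta>\<^sup>k\<close> in the products \<open>P\<^sub>j = \<theta> (\<theta> - a) \<dots> (\<theta> - (j - 1) a)\<close>: the coefficients are
  \<open>S(k, j) a\<^bsup>k-j\<^esup>\<close>, so that both sides agree coefficientwise in \<open>\<lambda>\<close> as soon as
  \<open>- Tr \<eta> Tr (P\<^sub>j / (\<theta> \<eta>)) = 1\<close> for all \<open>j\<close>, where \<open>\<eta> = \<theta>\<^bsup>\<tau>\<^esup>\<close>. Let \<open>\<sigma>\<close> be the \<open>a\<close>-th power of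
  Frobenius, so \<open>\<sigma> \<theta> = \<theta> + a\<close>. The exponent \<open>\<tau>\<close> is made so that \<open>\<sigma> \<eta> = \<theta> \<eta>\<close>. Hence \<open>\<sigma>\<close> maps
  \<open>P\<^sub>j\<^sub>+\<^sub>1 / (\<theta> \<eta>)\<close> to \<open>P\<^sub>j / (\<theta> \<eta>)\<close> and \<open>1 / \<eta>\<close> to \<open>1 / (\<theta> \<eta>)\<close>, and all these traces equal
  \<open>Tr (1 / \<eta>)\<close>. Finally \<open>Tr \<eta> Tr (1 / \<eta>)\<close> is the sum over \<open>s < p\<close> of the traces of
  \<open>\<sigma>\<^sup>s \<eta> / \<eta> = \<theta> (\<theta> + a) \<dots> (\<theta> + (s - 1) a)\<close>, which vanish for \<open>s < p - 1\<close> by telescoping and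
  equal \<open>-1\<close> for \<open>s = p - 1\<close>.
\<close>

section \<open>Expansion of powers in falling products with step \<open>h\<close>\<close>

lemma power_eq_sum_Stirling:
  fixes x h :: "'a::comm_ring_1"
  shows "x ^ n = (\<Sum>j\<le>n. of_nat (Stirling n j) * h ^ (n - j) * (\<Prod>i<j. x - of_nat i * h))"
proof (induction n)
  case 0
  show ?case by simp
next
  case (Suc n)
  define P where "P j = (\<Prod>i<j. x - of_nat i * h)" for j
  \<comment> \<open>Multiplying by \<open>x\<close> either lengthens the product or brings out
    \<open>j * h\<close>; these are the two terms of the Stirling recurrence.\<close>
  have P_Suc: "P j * x = P (Suc j) + of_nat j * h * P j" for j
    by (simp add: P_def algebra_simps)
  have "x ^ Suc n = (\<Sum>j\<le>n. of_nat (Stirling n j) * h ^ (n - j) * (P j * x))"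
    unfolding power_Suc2 Suc.IH P_def by (simp add: sum_distrib_right mult.assoc)
  also have "\<dots> = (\<Sum>j\<le>n. of_nat (Stirling n j) * h ^ (n - j) * P (Suc j)) +
      (\<Sum>j\<le>n. of_nat (j * Stirling n j) * h ^ (Suc n - j) * P j)"
    unfolding P_Suc sum.distrib[symmetric]
    by (intro sum.cong refl) (simp add: algebra_simps Suc_diff_le)
  \<comment> \<open>The added term has \<open>Stirling n (Suc n) = 0\<close>, and the term at 0
    carries the factor \<open>j = 0\<close>; so the index can be shifted to match the first
    sum.\<close>
  also have "(\<Sum>j\<le>n. of_nat (j * Stirling n j) * h ^ (Suc n - j) * P j) =
      (\<Sum>j\<le>Suc n. of_nat (j * Stirling n j) * h ^ (Suc n - j) * P j)"
    by simp
  also have "\<dots> = (\<Sum>j\<le>n. of_nat (Suc j * Stirling n (Suc j)) * h ^ (n - j) * P (Suc j))"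
    by (subst sum.atMost_Suc_shift) simp
  also have "(\<Sum>j\<le>n. of_nat (Stirling n j) * h ^ (n - j) * P (Suc j)) + \<dots> =
      (\<Sum>j\<le>n. of_nat (Stirling (Suc n) (Suc j)) * h ^ (n - j) * P (Suc j))"
    unfolding sum.distrib[symmetric] by (intro sum.cong refl) (simp add: algebra_simps)
  also have "\<dots> = (\<Sum>j\<le>Suc n. of_nat (Stirling (Suc n) j) * h ^ (Suc n - j) * P j)"
    by (subst sum.atMost_Suc_shift) simp
  finally show ?case unfolding P_def .
qed

section \<open>Powers of Frobenius and the trace\<close>

locale artin_schreier =
  fixes p a :: nat and \<theta> :: "'k::finite_field"
  assumes CHAR_k: "CHAR('k) = p"
    and card_k: "CARD('k) = p ^ p"
    and root: "\<theta> ^ p = \<theta> + 1"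
    and coprime: "coprime a p"
begin

lemma prime_p: "prime p"
  using CHAR_prime[where ?'a = 'k] CHAR_k by simp

lemma p_pos: "p > 0"
  using prime_p prime_gt_0_nat by blast

lemma of_nat_p [simp]: "of_nat p = (0 :: 'k)"
  using of_nat_CHAR[where ?'a = 'k] CHAR_k by simp

definition frob :: "nat \<Rightarrow> 'k \<Rightarrow> 'k" where
  "frob n x = x ^ (p ^ n)"

lemma frob_0 [simp]: "frob 0 x = x"
  by (simp add: frob_def)

lemma frob_add: "frob n (x + y) = frob n x + frob n y"
  unfolding frob_def using freshmans_dream'[of "p ^ n" n x y] prime_p CHAR_k by simp

lemma frob_sum: "frob n (sum f A) = (\<Sum>i\<in>A. frob n (f i))"
  unfolding frob_def using freshmans_dream_sum'[of "p ^ n" n f A] prime_p CHAR_k by simp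

lemma frob_mult: "frob n (x * y) = frob n x * frob n y"
  by (simp add: frob_def power_mult_distrib)

lemma frob_divide: "frob n (x / y) = frob n x / frob n y"
  by (simp add: frob_def power_divide)

lemma frob_prod: "frob n (prod f A) = (\<Prod>i\<in>A. frob n (f i))"
  by (simp add: frob_def prod_power_distrib)

lemma frob_power: "frob n (x ^ k) = frob n x ^ k"
  by (simp add: frob_def mult.commute flip: power_mult)

lemma frob_1 [simp]: "frob n 1 = 1"
  by (simp add: frob_def)

lemma frob_of_nat [simp]: "frob n (of_nat k) = of_nat k"
  using p_pos by (induction k) (simp_all add: frob_add, simp add: frob_def)

lemma frob_uminus: "frob n (- x) = - frob n x"
  using frob_add[of n x "- x"] p_pos
  by (simp add: add_eq_0_iff frob_def power_0_left)

lemma frob_diff: "frob n (x - y) = frob n x - frob n y"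
  using frob_add[of n x "- y"] by (simp add: frob_uminus)

lemma frob_frob: "frob m (frob n x) = frob (m + n) x"
  by (simp add: frob_def power_add mult.commute flip: power_mult)

lemma frob_p [simp]: "frob p x = x"
  using finite_field_power_card_eq_same[of x] card_k by (simp add: frob_def)

lemma frob_mod: "frob (n mod p) x = frob n x"
proof -
  have "frob (k + p * d) x = frob k x" for k d
    by (induction d) (simp_all add: algebra_simps flip: frob_frob)
  from this[of "n mod p" "n div p"] show ?thesis by simp
qed

lemma frob_theta [simp]: "frob n \<theta> = \<theta> + of_nat n"
proof (induction n)
  case (Suc n)
  have "frob (Suc n) \<theta> = frob n (frob 1 \<theta>)" by (simp add: frob_frob)
  also have "frob 1 \<theta> = \<theta> + 1" by (simp add: frob_def root)
  finally show ?case by (simp add: frob_add Suc.IH add_ac)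
qed simp

lemma theta_nonzero [simp]: "\<theta> \<noteq> 0"
  using root p_pos by (auto simp: power_0_left)

text \<open>The trace is kept inside \<open>'k\<close>, as the image of \<open>Tr\<close> under
  \<open>embed_Fp\<close>; descent to the prime field is left to the end.\<close>

definition tr :: "'k \<Rightarrow> 'k" where
  "tr x = (\<Sum>i<p. frob i x)"

lemma tr_sum: "tr (sum f A) = (\<Sum>i\<in>A. tr (f i))"
  unfolding tr_def frob_sum by (rule sum.swap)

lemma bij_betw_mult_mod: "bij_betw (\<lambda>k. k * a mod p) {..<p} {..<p}"
proof -
  have "inj_on (\<lambda>k. k * a mod p) {..<p}"
  proof (rule inj_onI)
    fix i j assume ij: "i \<in> {..<p}" "j \<in> {..<p}" and "i * a mod p = j * a mod p"
    hence "[i * a = j * a] (mod p)" by (simp add: cong_def)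
    hence "[i = j] (mod p)" using coprime cong_mult_rcancel_nat by blast
    thus "i = j" using ij by (simp add: cong_def)
  qed
  moreover have "(\<lambda>k. k * a mod p) ` {..<p} \<subseteq> {..<p}" using p_pos by auto
  ultimately show ?thesis by (simp add: bij_betw_def endo_inj_surj)
qed

text \<open>As \<open>a\<close> is a unit modulo \<open>p\<close>, the multiples of \<open>a\<close>
  run through all residues, so the trace may be summed along the powers of
  \<open>frob a\<close>.\<close>

lemma tr_eq: "tr x = (\<Sum>k<p. frob (k * a) x)"
  unfolding tr_def using sum.reindex_bij_betw[OF bij_betw_mult_mod, of "\<lambda>i. frob i x"]
  by (simp add: frob_mod)

lemma tr_frob [simp]: "tr (frob n x) = tr x"
proof -
  have "tr (frob 1 x) = tr x" for x
  proof -
    have "tr (frob 1 x) = (\<Sum>i<Suc p. frob i x) - x"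
      by (subst sum.lessThan_Suc_shift) (simp add: tr_def frob_frob)
    thus ?thesis by (simp add: tr_def)
  qed
  note 1 = this
  show ?thesis
  proof (induction n)
    case (Suc n)
    have "frob (Suc n) x = frob 1 (frob n x)" by (simp add: frob_frob)
    thus ?case using 1 Suc.IH by simp
  qed simp
qed

lemma frob_tr [simp]: "frob n (tr x) = tr x"
proof -
  have "frob n (tr x) = tr (frob n x)"
    by (simp add: tr_def frob_sum frob_frob add.commute)
  thus ?thesis by simp
qed

lemma tr_mult_left: "frob 1 c = c \<Longrightarrow> tr (c * x) = c * tr x"
proof -
  assume c: "frob 1 c = c"
  have "frob n c = c" for n
  proof (induction n)
    case (Suc n)
    have "frob (Suc n) c = frob 1 (frob n c)" by (simp add: frob_frob)
    thus ?case using Suc.IH c by simp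
  qed simp
  thus ?thesis by (simp add: tr_def frob_mult sum_distrib_left)
qed

section \<open>Norms of translates of \<theta>\<close>

lemma inj_on_of_nat_mult: "inj_on (\<lambda>i. of_nat (i * a) :: 'k) {..<p}"
proof (rule inj_onI)
  fix i j assume ij: "i \<in> {..<p}" "j \<in> {..<p}" and "of_nat (i * a) = (of_nat (j * a) :: 'k)"
  hence "[i * a = j * a] (mod p)" using of_nat_eq_iff_cong_CHAR[where ?'a = 'k] CHAR_k by metis
  hence "i * a mod p = j * a mod p" by (simp add: cong_def)
  thus "i = j" using bij_betw_mult_mod ij by (auto simp: bij_betw_def dest: inj_onD)
qed

lemma of_nat_a_nonzero [simp]: "of_nat a \<noteq> (0 :: 'k)"
  using inj_on_of_nat_mult[THEN inj_onD, of 0 1] prime_gt_1_nat[OF prime_p] by auto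

text \<open>Both sides have degree at most \<open>p\<close> and the same coefficient there, and both
  vanish at the \<open>p\<close> distinct points \<open>- of_nat (i * a)\<close> of the prime
  field.\<close>

lemma prod_linear_eq: "(\<Prod>i<p. [:of_nat (i * a), 1:]) = monom 1 p - (monom 1 1 :: 'k poly)"
proof (rule poly_eqI_degree_lead_coeff)
  let ?A = "(\<lambda>i. - of_nat (i * a) :: 'k) ` {..<p}"
  have p1: "p > 1" using prime_p prime_gt_1_nat by blast
  have deg: "degree (\<Prod>i<p. [:of_nat (i * a), 1 :: 'k:]) = p"
    by (subst degree_prod_eq_sum_degree) auto
  have "lead_coeff (\<Prod>i<p. [:of_nat (i * a), 1 :: 'k:]) = 1"
    by (simp add: lead_coeff_prod)
  hence "coeff (\<Prod>i<p. [:of_nat (i * a), 1 :: 'k:]) p = 1"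
    unfolding deg .
  thus "coeff (\<Prod>i<p. [:of_nat (i * a), 1:]) p = coeff (monom 1 p - (monom 1 1 :: 'k poly)) p"
    using p1 by simp
  show "degree (\<Prod>i<p. [:of_nat (i * a), 1 :: 'k:]) \<le> p" unfolding deg ..
  show "degree (monom 1 p - (monom 1 1 :: 'k poly)) \<le> p"
    using p1 by (intro degree_diff_le) (auto simp: degree_monom_eq)
  have "inj_on (\<lambda>i. - of_nat (i * a) :: 'k) {..<p}"
    using inj_on_of_nat_mult unfolding inj_on_def by auto
  thus "card ?A \<ge> p" by (simp add: card_image)
  fix z assume "z \<in> ?A"
  then obtain i where i: "i < p" "z = - of_nat (i * a)" by blast
  have "frob 1 z = z" by (simp only: i frob_uminus frob_of_nat)
  hence "z ^ p = z" by (simp add: frob_def)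
  moreover have "(\<Prod>i<p. z + of_nat (i * a)) = 0"
    using i by (intro prod_zero) auto
  ultimately show "poly (\<Prod>i<p. [:of_nat (i * a), 1:]) z = poly (monom 1 p - monom 1 1) z"
    by (simp add: poly_prod poly_monom add.commute)
qed

text \<open>The product is the value of \<open>X^p - X\<close> at \<open>\<theta> + c\<close>. For
  \<open>c\<close> in the prime field the shift cancels, and the equation of \<theta> leaves
  1.\<close>

lemma norm_shift: "(\<Prod>i<p. \<theta> + c + of_nat (i * a)) = 1" if "frob 1 c = c"
proof -
  have "(\<Prod>i<p. (\<theta> + c) + of_nat (i * a)) = poly (\<Prod>i<p. [:of_nat (i * a), 1:]) (\<theta> + c)"
    by (simp add: poly_prod add_ac)
  also have "\<dots> = frob 1 (\<theta> + c) - (\<theta> + c)"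
    by (simp only: prod_linear_eq) (simp add: poly_monom frob_def)
  also have "\<dots> = 1" using that by (simp add: frob_add)
  finally show ?thesis .
qed

lemma norm_theta: "(\<Prod>i<p. \<theta> + of_nat (i * a)) = 1"
  using norm_shift[of 0] p_pos by (simp add: frob_def)

lemma theta_shift_nonzero: "\<theta> + of_nat n \<noteq> 0"
  using frob_theta[of n] theta_nonzero by (metis frob_def power_eq_0_iff)

text \<open>The derivative of \<open>X\<^sup>p - X\<close> is \<open>-1\<close>, and at a root of \<open>X\<^sup>p - X - 1\<close> it is the sum of the
  conjugates of \<open>1 / \<theta>\<close>.\<close>

lemma tr_inverse_theta: "tr (1 / \<theta>) = -1"
proof -
  have "-1 = poly (pderiv (monom 1 p - monom 1 1)) \<theta>"
    by (simp add: pderiv_diff pderiv_monom)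
  also have "\<dots> = (\<Sum>k<p. \<Prod>i\<in>{..<p} - {k}. \<theta> + of_nat (i * a))"
    unfolding prod_linear_eq[symmetric] pderiv_prod
    by (simp add: poly_sum poly_prod pderiv_pCons add.commute)
  also have "\<dots> = (\<Sum>k<p. 1 / (\<theta> + of_nat (k * a)))"
  proof (rule sum.cong[OF refl])
    fix k assume "k \<in> {..<p}"
    hence "(\<theta> + of_nat (k * a)) * (\<Prod>i\<in>{..<p} - {k}. \<theta> + of_nat (i * a)) = 1"
      unfolding norm_theta[symmetric] by (intro prod.remove[symmetric]) auto
    thus "(\<Prod>i\<in>{..<p} - {k}. \<theta> + of_nat (i * a)) = 1 / (\<theta> + of_nat (k * a))"
      using theta_shift_nonzero[of "k * a"] by (simp add: nonzero_eq_divide_eq mult.commute)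
  qed
  also have "\<dots> = tr (1 / \<theta>)" unfolding tr_eq frob_divide by simp
  finally show ?thesis ..
qed

section \<open>Traces of rising products\<close>

definition rising :: "nat \<Rightarrow> 'k" where
  "rising s = (\<Prod>i<s. \<theta> + of_nat (i * a))"

lemma tr_rising_eq_0: "tr (rising s) = 0" if "Suc s < p"
proof -
  \<comment> \<open>A discrete antiderivative: \<open>G (Suc k)\<close> and \<open>G k\<close> share
    \<open>s\<close> factors, and the two remaining ones differ by \<open>Suc s * a\<close>.\<close>
  define G where "G k = (\<Prod>i<Suc s. \<theta> - of_nat a + of_nat ((i + k) * a))" for k
  have "of_nat (Suc s) * of_nat a * frob (k * a) (rising s) = G (Suc k) - G k" for k
  proof -
    define M where "M = (\<Prod>i<s. \<theta> + of_nat ((i + k) * a))"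
    have "frob (k * a) (rising s) = M"
      by (simp add: rising_def M_def frob_prod frob_add frob_mult algebra_simps)
    moreover have "G (Suc k) = M * (\<theta> + of_nat ((s + k) * a))"
      by (simp add: G_def M_def algebra_simps)
    moreover have "G k = (\<theta> - of_nat a + of_nat (k * a)) * M"
      unfolding G_def prod.lessThan_Suc_shift by (simp add: M_def algebra_simps)
    ultimately show ?thesis by (simp add: algebra_simps)
  qed
  hence "of_nat (Suc s) * of_nat a * tr (rising s) = (\<Sum>k<p. G (Suc k) - G k)"
    unfolding tr_eq sum_distrib_left by (intro sum.cong) simp_all
  also have "\<dots> = G p - G 0" by (rule sum_lessThan_telescope)
  \<comment> \<open>The telescoped sum covers a full period, since \<open>p\<close> is zero in
    \<open>'k\<close>.\<close>
  also have "G p = G 0" by (simp add: G_def algebra_simps)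
  finally have "of_nat (Suc s) * of_nat a * tr (rising s) = 0" by simp
  moreover have "of_nat (Suc s) \<noteq> (0 :: 'k)"
    using that CHAR_k by (metis of_nat_eq_0_iff_char_dvd nat_dvd_not_less zero_less_Suc)
  ultimately show ?thesis by simp
qed

text \<open>One more factor would complete the norm of \<theta>, which is 1; so this product is the
  inverse of a conjugate of \<theta>.\<close>

lemma tr_rising_last: "tr (rising (p - 1)) = -1"
proof -
  have p: "Suc (p - 1) = p" using p_pos by simp
  have "rising (p - 1) * (\<theta> + of_nat ((p - 1) * a)) = rising (Suc (p - 1))"
    by (simp add: rising_def)
  also have "\<dots> = 1" unfolding p rising_def by (rule norm_theta)
  finally have "rising (p - 1) = frob ((p - 1) * a) (1 / \<theta>)"
    using theta_shift_nonzero[of "(p - 1) * a"]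
    by (simp add: frob_divide nonzero_eq_divide_eq)
  thus ?thesis using tr_inverse_theta by simp
qed

section \<open>The element \<open>eta\<close> and its conjugates\<close>

definition eta :: 'k where
  "eta = \<theta> ^ tau p a"

lemma eta_nonzero [simp]: "eta \<noteq> 0"
  by (simp add: eta_def)

lemma a_pos: "a > 0"
  using of_nat_a_nonzero by (cases a) auto

text \<open>Each \<open>p\<close>-power in the exponent \<open>tau p a\<close> acts as a Frobenius
  power, turning \<theta> into a translate; the digit \<open>j\<close> becomes its
  multiplicity.\<close>

lemma eta_eq: "eta = (\<Prod>j<p. (\<theta> - 1 + of_nat (j * a)) ^ j)"
proof -
  have "eta = (\<Prod>j=1..p-1. frob (j * a - 1) \<theta> ^ j)"
    by (simp add: eta_def tau_def power_sum frob_def mult.commute flip: power_mult)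
  also have "\<dots> = (\<Prod>j=1..p-1. (\<theta> - 1 + of_nat (j * a)) ^ j)"
  proof (rule prod.cong[OF refl])
    fix j assume "j \<in> {1..p-1}"
    hence "j * a \<ge> 1" using a_pos by (simp add: Suc_leI)
    thus "frob (j * a - 1) \<theta> ^ j = (\<theta> - 1 + of_nat (j * a)) ^ j"
      by (simp add: of_nat_diff diff_add_eq add_diff_eq)
  qed
  also have "\<dots> = (\<Prod>j<p. (\<theta> - 1 + of_nat (j * a)) ^ j)"
    using p_pos by (intro prod.mono_neutral_left) (auto simp: not_less_eq_eq[symmetric])
  finally show ?thesis .
qed

text \<open>\<open>frob a\<close> moves \<open>b j\<close> to \<open>b (Suc j)\<close> but keeps the
  exponent \<open>j\<close>. Raising every exponent by one multiplies by a norm, hence by 1. The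
  result is the product for \<open>eta\<close> with one further factor
  \<open>b p ^ p = (\<theta> - 1) ^ p = \<theta>\<close>.\<close>

lemma frob_eta: "frob a eta = \<theta> * eta"
proof -
  define b where "b j = \<theta> - 1 + of_nat (j * a)" for j
  have frob_b: "frob a (b j) = b (Suc j)" for j
    by (simp add: b_def frob_add frob_diff frob_mult algebra_simps)
  have "(\<Prod>j<p. b (Suc j)) = (\<Prod>j<p. \<theta> + (of_nat a - 1) + of_nat (j * a))"
    by (simp add: b_def algebra_simps)
  also have "\<dots> = 1" by (rule norm_shift) (simp add: frob_diff)
  finally have norm_b: "(\<Prod>j<p. b (Suc j)) = 1" .
  have "frob a eta = (\<Prod>j<p. b (Suc j) ^ j)"
    unfolding eta_eq frob_prod frob_power b_def[symmetric] frob_b ..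
  also have "\<dots> = (\<Prod>j<p. b (Suc j) ^ j) * (\<Prod>j<p. b (Suc j))"
    by (simp only: norm_b mult_1_right)
  also have "\<dots> = (\<Prod>j<p. b (Suc j) ^ Suc j)"
    by (simp add: mult.commute flip: prod.distrib)
  also have "\<dots> = (\<Prod>j<Suc p. b j ^ j)"
    by (subst prod.lessThan_Suc_shift) simp
  also have "\<dots> = eta * b p ^ p" by (simp add: eta_eq b_def)
  also have "b p ^ p = frob 1 (\<theta> - 1)" by (simp add: b_def frob_def)
  also have "\<dots> = \<theta>" by (simp add: frob_diff)
  finally show ?thesis by (simp add: mult.commute)
qed

lemma frob_mult_eta: "frob (s * a) eta = rising s * eta"
proof (induction s)
  case (Suc s)
  have "frob (Suc s * a) eta = frob (s * a) (frob a eta)"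
    by (simp add: frob_frob add.commute)
  thus ?case using Suc.IH by (simp add: frob_eta frob_mult rising_def)
qed (simp add: rising_def)

lemma tr_eta_mult_tr_inverse: "tr eta * tr (1 / eta) = -1"
proof -
  \<comment> \<open>\<open>tr eta\<close> is fixed by Frobenius, so it may enter the other trace as
    a scalar.\<close>
  have "tr eta * tr (1 / eta) = tr (tr eta * (1 / eta))"
    by (rule tr_mult_left[symmetric]) simp
  also have "tr eta * (1 / eta) = (\<Sum>s<p. rising s)"
    by (simp add: tr_eq frob_mult_eta flip: sum_distrib_right)
  also have "tr \<dots> = (\<Sum>s<p. tr (rising s))" by (rule tr_sum)
  also have "\<dots> = (\<Sum>s<Suc (p - 1). tr (rising s))" using p_pos by simp
  also have "\<dots> = (\<Sum>s<p - 1. tr (rising s)) + tr (rising (p - 1))"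
    by (rule sum.lessThan_Suc)
  also have "\<dots> = -1" unfolding tr_rising_last by (simp add: tr_rising_eq_0)
  finally show ?thesis .
qed

text \<open>Under \<open>frob a\<close> numerator and denominator both acquire the factor
  \<open>\<theta> + of_nat a\<close>, which cancels; the numerator loses its last factor.\<close>

lemma tr_falling:
  "tr ((\<Prod>i<j. \<theta> - of_nat i * of_nat a) / (\<theta> * eta)) = tr (1 / eta)"
proof (induction j)
  case 0
  have "1 / (\<theta> * eta) = frob a (1 / eta)" by (simp add: frob_divide frob_eta)
  thus ?case by simp
next
  case (Suc j)
  define P where "P j = (\<Prod>i<j. \<theta> - of_nat i * of_nat a)" for j
  have "frob a (P (Suc j)) = (\<Prod>i<Suc j. \<theta> + of_nat a - of_nat i * of_nat a)"
    by (simp add: P_def frob_prod frob_diff frob_mult frob_add)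
  also have "\<dots> = (\<theta> + of_nat a) * P j"
    unfolding prod.lessThan_Suc_shift by (simp add: P_def algebra_simps)
  finally have "frob a (P (Suc j) / (\<theta> * eta)) = P j / (\<theta> * eta)"
    using theta_shift_nonzero[of a] by (simp add: frob_divide frob_mult frob_eta)
  hence "tr (P (Suc j) / (\<theta> * eta)) = tr (P j / (\<theta> * eta))" by (metis tr_frob)
  thus ?case using Suc.IH by (simp add: P_def)
qed

lemma Stirling_sum_eq_tr:
  "(\<Sum>j\<le>k. of_nat (Stirling k j) * of_nat a ^ (k - j)) =
    - (tr (\<theta> ^ tau p a) * tr (\<theta> ^ k / \<theta> ^ (1 + tau p a)))"
proof -
  define c where "c j = (of_nat (Stirling k j * a ^ (k - j)) :: 'k)" for j
  define P where "P j = (\<Prod>i<j. \<theta> - of_nat i * of_nat a)" for j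
  have "\<theta> ^ k / (\<theta> * eta) = (\<Sum>j\<le>k. c j * (P j / (\<theta> * eta)))"
    by (subst power_eq_sum_Stirling[where h = "of_nat a"])
       (simp add: sum_divide_distrib P_def c_def)
  hence "tr (\<theta> ^ k / (\<theta> * eta)) = (\<Sum>j\<le>k. tr (c j * (P j / (\<theta> * eta))))"
    by (simp only: tr_sum)
  also have "\<dots> = (\<Sum>j\<le>k. c j * tr (1 / eta))"
    by (intro sum.cong refl)
       (simp only: c_def tr_mult_left[OF frob_of_nat] P_def tr_falling)
  also have "\<dots> = (\<Sum>j\<le>k. c j) * tr (1 / eta)"
    by (rule sum_distrib_right[symmetric])
  finally have "tr eta * tr (\<theta> ^ k / (\<theta> * eta)) = (\<Sum>j\<le>k. c j) * (tr eta * tr (1 / eta))"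
    by (simp only: mult_ac)
  also have "\<dots> = - (\<Sum>j\<le>k. c j)"
    by (simp only: tr_eta_mult_tr_inverse mult_minus1_right)
  finally have "tr eta * tr (\<theta> ^ k / (\<theta> * eta)) = - (\<Sum>j\<le>k. c j)" .
  thus ?thesis by (simp add: eta_def c_def)
qed

end

section \<open>Coefficients in \<lambda> and descent to the prime field\<close>

lemma coeff_weighted_bell_mod:
  fixes c :: "'p::prime_card mod_ring"
  shows "coeff (weighted_bell_mod n c) i =
    (\<Sum>j\<le>n. (if i \<le> n then of_nat ((n choose i) * Stirling (n - i) j) else 0) * c ^ j)"
proof -
  have R: "coeff (stirling_R n j) i =
      (if i \<le> n then of_nat ((n choose i) * Stirling (n - i) j) else 0)" for j
  proof -
    have "coeff (stirling_R n j) i =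
        (\<Sum>m\<le>n. if n - m = i then of_nat ((n choose m) * Stirling m j) else 0)"
      unfolding stirling_R_def coeff_sum coeff_monom by (simp cong: if_cong)
    \<comment> \<open>For \<open>i > n\<close> the truncated \<open>n - i\<close> is 0, so the guard
      \<open>i \<le> n\<close> keeps out a spurious term at \<open>m = 0\<close>.\<close>
    also have "\<dots> = (\<Sum>m\<le>n. if m = n - i \<and> i \<le> n then of_nat ((n choose m) * Stirling m j) else 0)"
      by (intro sum.cong refl) auto
    also have "\<dots> = (if i \<le> n then of_nat ((n choose i) * Stirling (n - i) j) else 0)"
      by (auto simp: binomial_symmetric[of i n])
    finally show ?thesis .
  qed
  interpret map_poly_comm_ring_hom "map_poly of_int :: int poly \<Rightarrow> 'p mod_ring poly" ..
  have "weighted_bell_mod n c =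
      (\<Sum>j\<le>n. map_poly of_int (stirling_R n j) * [:c:] ^ j)"
    unfolding weighted_bell_mod_def weighted_bell_def
    by (simp add: hom_sum poly_sum poly_monom)
  thus ?thesis
    by (cases "i \<le> n") (simp_all add: coeff_sum R poly_const_pow mult.commute del: of_nat_mult)
qed

theorem theorem3p1:
  fixes p a m :: nat and \<theta> :: "'k::finite_field"
  assumes "prime p"
    and "CARD('p::prime_card) = p"
    and "CARD('k) = p ^ p"
    and "gcd a p = 1"
    and "\<theta> ^ p = \<theta> + 1"
  shows "smult (of_nat a ^ m) (weighted_bell_mod m (inverse (of_nat a)) :: 'p mod_ring poly) =
    - smult (Tr (\<theta> ^ tau p a))
        (map_poly Tr (smult (1 / \<theta> ^ (1 + tau p a)) ([:\<theta>, of_nat a:] ^ m)))"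
proof (rule poly_eqI)
  fix n
  have card_pp: "CARD('k) = CARD('p) ^ CARD('p)" using assms(2,3) by simp
  interpret artin_schreier p a \<theta>
    by unfold_locales
       (use assms CHAR_eq_CARD[OF card_pp] in \<open>simp_all add: coprime_iff_gcd_eq_1\<close>)
  have embed_nat: "embed_Fp (of_nat k :: 'p mod_ring) = (of_nat k :: 'k)" for k
    using embed_Fp_of_int[OF card_pp, of "int k"] by simp
  have embed_Tr: "embed_Fp (Tr x :: 'p mod_ring) = tr x" for x :: 'k
    using embed_Fp_Tr[OF card_pp, of x] assms(2) by (simp add: tr_def frob_def)
  have embed_eq: "c = d" if "embed_Fp c = (embed_Fp d :: 'k)" for c d :: "'p mod_ring"
    using inj_embed_Fp[OF card_pp] that by (rule injD)
  have a0: "of_nat a \<noteq> (0 :: 'p mod_ring)"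
    using embed_nat[of a] embed_nat[of 0] of_nat_a_nonzero by fastforce
  \<comment> \<open>\<open>map_poly\<close> acts coefficientwise only for maps sending 0 to
    0.\<close>
  have Tr_0: "Tr (0 :: 'k) = (0 :: 'p mod_ring)"
    by (rule embed_eq) (use embed_nat[of 0] p_pos in \<open>simp add: embed_Tr tr_def frob_def power_0_left\<close>)
  show "coeff (smult (of_nat a ^ m) (weighted_bell_mod m (inverse (of_nat a)) :: 'p mod_ring poly)) n =
    coeff (- smult (Tr (\<theta> ^ tau p a))
        (map_poly Tr (smult (1 / \<theta> ^ (1 + tau p a)) ([:\<theta>, of_nat a:] ^ m)))) n"
  proof (cases "n \<le> m")
    case False
    hence "coeff ([:\<theta>, of_nat a:] ^ m) n = 0"
      by (intro coeff_eq_0) (simp add: degree_power_eq)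
    thus ?thesis using False by (simp add: coeff_weighted_bell_mod coeff_map_poly Tr_0)
  next
    case True
    define k where "k = m - n"
    have m: "m = n + k" using True by (simp add: k_def)
    let ?q = "(m choose n) * a ^ n"
    let ?S = "\<Sum>j\<le>k. Stirling k j * a ^ (k - j)"
    have "coeff (smult (of_nat a ^ m) (weighted_bell_mod m (inverse (of_nat a)))) n =
        (\<Sum>j\<le>m. of_nat ((m choose n) * Stirling k j) * (of_nat a ^ m * inverse (of_nat a) ^ j) :: 'p mod_ring)"
      using True by (simp add: coeff_weighted_bell_mod k_def sum_distrib_left mult_ac)
    \<comment> \<open>\<open>Stirling k j\<close> vanishes for \<open>j > k\<close>; afterwards
      \<open>k - j\<close> is a genuine difference and \<open>inverse (of_nat a) ^ j\<close> cancels
      against \<open>of_nat a ^ m\<close>.\<close>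
    also have "\<dots> = (\<Sum>j\<le>k. of_nat ((m choose n) * Stirling k j) * (of_nat a ^ m * inverse (of_nat a) ^ j))"
      by (rule sum.mono_neutral_right) (auto simp: m)
    also have "\<dots> = (\<Sum>j\<le>k. of_nat ((m choose n) * Stirling k j) * of_nat (a ^ (n + (k - j))))"
    proof (intro sum.cong refl arg_cong2[where f = "(*)"])
      fix j assume "j \<in> {..k}"
      hence "m = n + (k - j) + j" by (simp add: m)
      hence "of_nat a ^ m = of_nat a ^ (n + (k - j)) * (of_nat a ^ j :: 'p mod_ring)"
        by (metis power_add)
      thus "of_nat a ^ m * inverse (of_nat a) ^ j = (of_nat (a ^ (n + (k - j))) :: 'p mod_ring)"
        using a0 by (simp add: power_inverse)
    qed
    also have "\<dots> = of_nat (?q * ?S)"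
      unfolding of_nat_mult of_nat_sum sum_distrib_left power_add
      by (intro sum.cong refl) (simp only: mult_ac)
    finally have lhs: "coeff (smult (of_nat a ^ m) (weighted_bell_mod m (inverse (of_nat a)))) n =
        (of_nat (?q * ?S) :: 'p mod_ring)" .
    have "coeff (smult (1 / \<theta> ^ (1 + tau p a)) ([:\<theta>, of_nat a:] ^ m)) n =
        of_nat ?q * (\<theta> ^ k / \<theta> ^ (1 + tau p a))"
      using True by (simp add: coeff_linear_poly_power k_def)
    hence rhs: "coeff (- smult (Tr (\<theta> ^ tau p a))
        (map_poly Tr (smult (1 / \<theta> ^ (1 + tau p a)) ([:\<theta>, of_nat a:] ^ m)))) n =
        - (Tr (\<theta> ^ tau p a) * Tr (of_nat ?q * (\<theta> ^ k / \<theta> ^ (1 + tau p a))) :: 'p mod_ring)"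
      by (simp only: coeff_minus coeff_smult coeff_map_poly Tr_0)
    \<comment> \<open>The equation is moved to one side, so that additivity, multiplicativity and
      injectivity of \<open>embed_Fp\<close> carry it back from \<open>'k\<close>.\<close>
    have "embed_Fp (of_nat (?q * ?S) +
        Tr (\<theta> ^ tau p a) * Tr (of_nat ?q * (\<theta> ^ k / \<theta> ^ (1 + tau p a))) :: 'p mod_ring) =
        of_nat ?q * (of_nat ?S + tr (\<theta> ^ tau p a) * tr (\<theta> ^ k / \<theta> ^ (1 + tau p a)))"
      by (simp only: embed_Fp_add[OF card_pp] embed_Fp_mult[OF card_pp] embed_Tr embed_nat
          tr_mult_left[OF frob_of_nat] of_nat_mult[of ?q ?S]) (simp only: algebra_simps)
    also have "\<dots> = 0" using Stirling_sum_eq_tr[of k] by simp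
    also have "(0 :: 'k) = embed_Fp (0 :: 'p mod_ring)" using embed_nat[of 0] by simp
    finally have "of_nat (?q * ?S) +
        Tr (\<theta> ^ tau p a) * Tr (of_nat ?q * (\<theta> ^ k / \<theta> ^ (1 + tau p a))) = (0 :: 'p mod_ring)"
      by (rule embed_eq)
    thus ?thesis unfolding lhs rhs by (simp only: add_eq_0_iff2 add_eq_0_iff minus_minus)
  qed
qed

end
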